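(* Let $0<q\le p$ satisfy $p^2+q^2<1$, and suppose there exists $\tilde\delta\in(0,1)$ such that $\mathcal S_{p,q}(\delta)<0$ for all $0<\delta<\tilde\delta$, so that a non-trivial steady state $g_\infty$ of the scaled Boltzmann equation $$\partial_t\hat g(\xi,t)+\tfrac12(p^2+q^2-1)\,\xi\,\partial_\xi\hat g(\xi,t)=\hat g(p\xi,t)\,\hat g(q\xi,t)-\hat g(\xi,t)$$ exists. Let $\lambda\in(0,2)$ be the exponent such that $p^\lambda+q^\lambda=1$. Then $g_\infty$ is a smooth function and belongs to the $\lambda$-th Gevrey class $G^\lambda(\mathbb R)$, i.e. there exist $\rho>0$ and $\mu>0$ such that $$|\hat g_\infty(\xi)|\le\exp(-\mu|\xi|^\lambda),\qquad|\xi|>\rho .$$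
   Context: For $p,q>0$ and $\delta\ge0$, $\mathcal S_{p,q}(\delta)=p^{2+\delta}+q^{2+\delta}-1-\frac{2+\delta}{2}\,(p^2+q^2-1)$. The Fourier transform is $\hat h(\xi)=\int_{\mathbb R}h(v)e^{-i\xi v}\,dv$. Under the stated assumptions on $p,q,\tilde\delta$ it is known (Pareschi–Toscani) that the scaled equation has a unique steady state $g_\infty$, that is, a unique $g_\infty\ge0$ with $\int_{\mathbb R} g_\infty\,dv=1$, $\int_{\mathbb R} v g_\infty\,dv=0$, $\int_{\mathbb R} v^2g_\infty\,dv=1$, $\int_{\mathbb R}|v|^{2+\delta}g_\infty\,dv<+\infty$ for every $0<\delta<\tilde\delta$, and $$\tfrac12(p^2+q^2-1)\,\xi\,\frac{d\hat g_\infty}{d\xi}(\xi)=\hat g_\infty(p\xi)\,\hat g_\infty(q\xi)-\hat g_\infty(\xi),\qquad\xi\in\mathbb R .$$ Membership in $G^\lambda(\mathbb R)$ means precisely the displayed exponential decay of the Fourier transform. *)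

theory Defs
  imports "HOL-Analysis.Analysis"
begin

definition S_fun :: "real \<Rightarrow> real \<Rightarrow> real \<Rightarrow> real" where
  "S_fun p q \<delta> =
     p powr (2 + \<delta>) + q powr (2 + \<delta>) - 1 - (2 + \<delta>) / 2 * (p\<^sup>2 + q\<^sup>2 - 1)"

definition fourier :: "(real \<Rightarrow> real) \<Rightarrow> real \<Rightarrow> complex" where
  "fourier h \<xi> = (LINT v|lborel. complex_of_real (h v) * exp (- \<i> * complex_of_real (\<xi> * v)))"

text \<open>
  Densities are defined up to null sets, hence the nonnegativity almost everywhere. Using
  \<^const>\<open>has_bochner_integral\<close> includes the integrability of the integrand. The finiteness of
  the moments already makes the Fourier transform differentiable; this is stated explicitly only
  because \<^const>\<open>vector_derivative\<close> is a total function.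
\<close>

definition steady_state :: "real \<Rightarrow> real \<Rightarrow> real \<Rightarrow> (real \<Rightarrow> real) \<Rightarrow> bool" where
  "steady_state p q \<delta>0 g \<longleftrightarrow>
     (AE v in lborel. 0 \<le> g v) \<and>
     has_bochner_integral lborel g 1 \<and>
     has_bochner_integral lborel (\<lambda>v. v * g v) 0 \<and>
     has_bochner_integral lborel (\<lambda>v. v\<^sup>2 * g v) 1 \<and>
     (\<forall>\<delta>. 0 < \<delta> \<and> \<delta> < \<delta>0 \<longrightarrow> integrable lborel (\<lambda>v. \<bar>v\<bar> powr (2 + \<delta>) * g v)) \<and>
     (\<forall>\<xi>. fourier g differentiable (at \<xi>) \<and>
          complex_of_real (1 / 2 * (p\<^sup>2 + q\<^sup>2 - 1) * \<xi>) * vector_derivative (fourier g) (at \<xi>)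
            = fourier g (p * \<xi>) * fourier g (q * \<xi>) - fourier g \<xi>)"

definition smooth :: "(real \<Rightarrow> real) \<Rightarrow> bool" where
  "smooth f \<longleftrightarrow> (\<forall>n x. (deriv ^^ n) f differentiable (at x))"

text \<open>An integrable function is smooth as an element of the Lebesgue space \<open>L\<^sup>1\<close>.\<close>

definition smooth_ae :: "(real \<Rightarrow> real) \<Rightarrow> bool" where
  "smooth_ae g \<longleftrightarrow> (\<exists>f. smooth f \<and> (AE v in lborel. g v = f v))"

definition gevrey :: "real \<Rightarrow> (real \<Rightarrow> real) \<Rightarrow> bool" where
  "gevrey \<kappa> g \<longleftrightarrow>
     (\<exists>\<rho> \<mu>. \<rho> > 0 \<and> \<mu> > 0 \<and>
        (\<forall>\<xi>. \<bar>\<xi>\<bar> > \<rho> \<longrightarrow> cmod (fourier g \<xi>) \<le> exp (- \<mu> * \<bar>\<xi>\<bar> powr \<kappa>)))"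

end

theory Submission
  imports Defs "HOL-Probability.Levy" "HOL-Real_Asymp.Real_Asymp"
begin

text \<open>
  Write \<open>\<phi>\<close> for the Fourier transform of the steady state and put \<open>c = (1 - p\<^sup>2 - q\<^sup>2) / 2 > 0\<close>. The
  equation \<open>c \<xi> \<phi>' \<xi> = \<phi> \<xi> - \<phi> (p \<xi>) \<phi> (q \<xi>)\<close> is linear of first order in \<open>\<phi>\<close> once the product is
  regarded as known. Its bounded solution is, for \<open>\<xi> > 0\<close>, a weighted average of the values
  \<open>\<phi> (p s) \<phi> (q s)\<close> over \<open>s \<ge> \<xi>\<close> (lemma \<open>norm_le_of_dilation_equation\<close>). So the decreasing majorant
  \<open>M \<xi> = sup {\<bar>\<phi> s\<bar> | s \<ge> \<xi>}\<close> satisfies \<open>M \<xi> \<le> M (p \<xi>) M (q \<xi>)\<close>.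

  This inequality propagates a bound \<open>M \<xi> \<le> exp (- \<mu> \<xi>\<^sup>\<lambda>)\<close> outwards, because \<open>p\<^sup>\<lambda> + q\<^sup>\<lambda> = 1\<close> makes the
  right-hand side reproduce itself (lemma \<open>stretched_exponential_decay\<close>). All it needs to start is
  \<open>M < 1\<close> somewhere, and since \<open>g\<close> is integrable this follows from the Riemann--Lebesgue lemma. Some
  input beyond the equation is indispensable here: the transform of a point mass at the origin
  solves it as well. The bound carries over to negative frequencies because \<open>g\<close> is real, and this
  is the Gevrey estimate.

  The Gevrey estimate makes every \<open>t\<^sup>n \<phi> t\<close> integrable. Levy's inversion formula for distribution
  functions, differentiated under the integral sign, then produces a smooth density for the law with
  density \<open>g\<close>, which must agree with \<open>g\<close> almost everywhere
  (lemma \<open>smooth_ae_of_rapidly_decreasing_fourier\<close>).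
\<close>

section \<open>The Riemann--Lebesgue lemma\<close>

lemma norm_fourier_kernel: "cmod (exp (- \<i> * complex_of_real (\<xi> * v))) = 1"
  using norm_exp_i_times[of "- (\<xi> * v)"] by simp

lemma integrable_fourier_kernel:
  assumes "integrable lborel h"
  shows "integrable lborel (\<lambda>v. complex_of_real (h v) * exp (- \<i> * complex_of_real (\<xi> * v)))"
proof (rule Bochner_Integration.integrable_bound[OF assms])
  show "(\<lambda>v. complex_of_real (h v) * exp (- \<i> * complex_of_real (\<xi> * v))) \<in> borel_measurable lborel"
    using borel_measurable_integrable[OF assms] by measurable
  show "AE v in lborel. norm (complex_of_real (h v) * exp (- \<i> * complex_of_real (\<xi> * v))) \<le> norm (h v)"
    by (simp only: norm_mult norm_fourier_kernel) simp
qed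

lemma norm_fourier_le:
  "cmod (fourier h \<xi>) \<le> (LINT v|lborel. \<bar>h v\<bar>)"
  unfolding fourier_def
  by (rule order_trans[OF integral_norm_bound]) (simp only: norm_mult norm_fourier_kernel norm_of_real, simp)

lemma fourier_add:
  assumes "integrable lborel h" "integrable lborel k"
  shows "fourier (\<lambda>v. h v + k v) \<xi> = fourier h \<xi> + fourier k \<xi>"
  unfolding fourier_def
  using Bochner_Integration.integral_add[OF assms[THEN integrable_fourier_kernel, of \<xi>]]
  by (simp add: distrib_right)

lemma fourier_scale: "fourier (\<lambda>v. c * h v) \<xi> = complex_of_real c * fourier h \<xi>"
  unfolding fourier_def by (simp add: mult.assoc)

lemma fourier_minus: "fourier h (- \<xi>) = cnj (fourier h \<xi>)"
  unfolding fourier_def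
  by (subst Bochner_Integration.integral_cnj[symmetric]) (simp add: exp_cnj)

text \<open>
  The transform of an \<open>L\<^sup>1\<close> limit is the uniform limit of the transforms, so decay at infinity survives
  \<open>L\<^sup>1\<close> convergence. The limit is required in the dominated pointwise form in which it occurs below.
\<close>

lemma fourier_vanishes_limit:
  fixes s :: "nat \<Rightarrow> real \<Rightarrow> real"
  assumes s: "\<And>i. integrable lborel (s i)" and f: "integrable lborel f" and w: "integrable lborel w"
    and lim: "\<And>x. (\<lambda>i. s i x) \<longlonglongrightarrow> f x" and bound: "\<And>i x. \<bar>s i x\<bar> \<le> w x"
    and vanish: "\<And>i. (fourier (s i) \<longlongrightarrow> 0) at_infinity"
  shows "(fourier f \<longlongrightarrow> 0) at_infinity"
proof (rule tendstoI)
  fix e :: real assume e: "e > 0"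
  have "(\<lambda>i. LINT v|lborel. \<bar>f v - s i v\<bar>) \<longlonglongrightarrow> (LINT (v::real)|lborel. (0::real))"
  proof (rule Bochner_Integration.integral_dominated_convergence[where w = "\<lambda>x. \<bar>f x\<bar> + w x"])
    show "AE x in lborel. (\<lambda>i. \<bar>f x - s i x\<bar>) \<longlonglongrightarrow> 0"
    proof (rule AE_I2)
      fix x
      show "(\<lambda>i. \<bar>f x - s i x\<bar>) \<longlonglongrightarrow> 0"
        using tendsto_rabs_zero[OF LIM_zero[OF lim[of x]]] by (simp add: abs_minus_commute)
    qed
    have "\<bar>\<bar>f x - s i x\<bar>\<bar> \<le> \<bar>f x\<bar> + w x" for i x
      using bound[of i x] by arith
    then show "AE x in lborel. norm \<bar>f x - s i x\<bar> \<le> \<bar>f x\<bar> + w x" for i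
      by auto
  qed (use s f w in auto)
  then have "(\<lambda>i. LINT v|lborel. \<bar>f v - s i v\<bar>) \<longlonglongrightarrow> 0" by simp
  from order_tendstoD(2)[OF this, of "e / 2"] e
  obtain i where i: "(LINT v|lborel. \<bar>f v - s i v\<bar>) < e / 2"
    by (auto simp: eventually_sequentially)
  have "\<forall>\<^sub>F \<xi> in at_infinity. dist (fourier (s i) \<xi>) 0 < e / 2"
    using vanish[of i] e by (intro tendstoD) auto
  then show "\<forall>\<^sub>F \<xi> in at_infinity. dist (fourier f \<xi>) 0 < e"
  proof eventually_elim
    case (elim \<xi>)
    have "fourier f \<xi> = fourier (s i) \<xi> + fourier (\<lambda>v. f v - s i v) \<xi>"
      using fourier_add[of "s i" "\<lambda>v. f v - s i v" \<xi>] s f by simp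
    moreover have "cmod (fourier (\<lambda>v. f v - s i v) \<xi>) < e / 2"
      using norm_fourier_le i by (rule le_less_trans)
    ultimately show ?case
      using elim norm_triangle_ineq[of "fourier (s i) \<xi>" "fourier (\<lambda>v. f v - s i v) \<xi>"]
      by simp
  qed
qed

lemma fourier_indicator_Icc_vanishes:
  "(fourier (indicator {a..b}) \<longlongrightarrow> 0) at_infinity"
proof (cases "a \<le> b")
  case True
  have "cmod (fourier (indicator {a..b}) \<xi>) \<le> 2 * inverse (norm \<xi>)" if "\<xi> \<noteq> 0" for \<xi>
  proof -
    let ?F = "\<lambda>v. exp (- \<i> * complex_of_real (\<xi> * v)) / (- \<i> * complex_of_real \<xi>)"
    have "(LINT v|lborel. indicator {a..b} v *\<^sub>R exp (- \<i> * complex_of_real (\<xi> * v))) = ?F b - ?F a"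
    proof (rule integral_FTC_atLeastAtMost[OF True])
      show "(?F has_vector_derivative exp (- \<i> * complex_of_real (\<xi> * x))) (at x within {a..b})" for x
        using that by (auto intro!: derivative_eq_intros has_vector_derivative_real_field simp: field_simps)
    qed (intro continuous_intros)
    moreover have "complex_of_real (indicator {a..b} v) * z = indicator {a..b} v *\<^sub>R z" for v z
      by (simp add: scaleR_conv_of_real)
    ultimately have "fourier (indicator {a..b}) \<xi> = ?F b - ?F a"
      unfolding fourier_def by simp
    also have "cmod \<dots> \<le> cmod (?F b) + cmod (?F a)" by (rule norm_triangle_ineq4)
    also have "\<dots> = 2 * inverse (norm \<xi>)"
      unfolding norm_divide norm_fourier_kernel by (simp add: norm_mult field_simps)
    finally show ?thesis .
  qed
  then have "\<forall>\<^sub>F \<xi> in at_infinity. norm (fourier (indicator {a..b}) \<xi>) \<le> 2 * inverse (norm \<xi>)"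
    by (auto simp: eventually_at_infinity intro!: exI[of _ 1])
  moreover have "((\<lambda>\<xi>::real. 2 * inverse (norm \<xi>)) \<longlongrightarrow> 0) at_infinity"
    using tendsto_mult_left[OF tendsto_norm_zero[OF tendsto_inverse_0[where 'a = real]], of 2]
    by simp
  ultimately show ?thesis by (rule Lim_null_comparison)
next
  case False
  then show ?thesis by (simp add: fourier_def[abs_def])
qed

lemma integrable_indicator_Int_Icc:
  fixes a b :: real
  assumes "A \<in> sets borel"
  shows "integrable lborel (indicator (A \<inter> {a..b}) :: real \<Rightarrow> real)"
proof (rule integrable_real_indicator)
  have "emeasure lborel (A \<inter> {a..b}) \<le> emeasure lborel {a..b}"
    by (intro emeasure_mono) auto
  also have "\<dots> < \<infinity>" by (simp add: emeasure_lborel_Icc_eq)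
  finally show "emeasure lborel (A \<inter> {a..b}) < \<infinity>" .
qed (use assms in auto)

text \<open>
  Intervals are stable under intersection, and the sets whose indicator has a decaying transform are
  closed under complements and countable disjoint unions. The truncation to a bounded window keeps
  complements and unions integrable.
\<close>

lemma fourier_indicator_bounded_vanishes:
  assumes "A \<in> sets borel"
  shows "(fourier (indicator (A \<inter> {-c..c})) \<longlongrightarrow> 0) at_infinity"
  using assms
proof (induction rule: borel_set_induct)
  case empty
  then show ?case by (simp add: fourier_def[abs_def])
next
  case (interval a b)
  then show ?case using fourier_indicator_Icc_vanishes by (simp add: Int_atLeastAtMost)
next
  case (compl A)
  have "(\<lambda>v. indicator (- A \<inter> {-c..c}) v) = (\<lambda>v. indicator {-c..c} v + (-1) * (indicator (A \<inter> {-c..c}) v :: real))"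
    by (auto simp: fun_eq_iff split: split_indicator)
  moreover have "fourier \<dots> = (\<lambda>\<xi>. fourier (indicator {-c..c}) \<xi> + (-1) * fourier (indicator (A \<inter> {-c..c})) \<xi>)"
    using integrable_indicator_Int_Icc[of UNIV "-c" c] integrable_indicator_Int_Icc[OF compl(1), of "-c" c]
    by (intro ext, subst fourier_add) (auto simp: fourier_scale[of "-1", simplified])
  ultimately show ?case
    using tendsto_diff[OF fourier_indicator_Icc_vanishes compl(2)] by simp
next
  case (union B)
  let ?U = "\<lambda>n. (\<Union>i<n. B i) \<inter> {-c..c}"
  have van: "(fourier (indicator (?U n)) \<longlongrightarrow> 0) at_infinity" for n
  proof (induction n)
    case 0
    then show ?case by (simp add: fourier_def[abs_def])
  next
    case (Suc n)
    have "B i \<inter> B n = {}" if "i < n" for i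
      using disjoint_family_onD[OF union(1), of i n] that by simp
    then have "x \<notin> (\<Union>i<n. B i)" if "x \<in> B n" for x
      using that by blast
    then have "(\<lambda>v. indicator (?U (Suc n)) v) = (\<lambda>v. indicator (?U n) v + (indicator (B n \<inter> {-c..c}) v :: real))"
      by (auto simp: fun_eq_iff less_Suc_eq split: split_indicator)
    moreover have "fourier \<dots> = (\<lambda>\<xi>. fourier (indicator (?U n)) \<xi> + fourier (indicator (B n \<inter> {-c..c})) \<xi>)"
      using union(2) by (intro ext fourier_add integrable_indicator_Int_Icc) auto
    ultimately show ?case using tendsto_add[OF Suc union(3)[of n]] by simp
  qed
  show ?case
  proof (rule fourier_vanishes_limit[where w = "indicator {-c..c}", OF _ _ _ _ _ van])
    show "(\<lambda>n. indicator (?U n) x :: real) \<longlonglongrightarrow> indicator ((\<Union>i. B i) \<inter> {-c..c}) x" for x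
    proof (cases "x \<in> (\<Union>i. B i) \<inter> {-c..c}")
      case True
      then obtain k where "x \<in> B k" by auto
      with True have "\<forall>n\<ge>Suc k. (indicator (?U n) x :: real) = 1"
        by (auto split: split_indicator intro: bexI[of _ k])
      with True show ?thesis
        by (intro tendsto_eventually) (auto simp: eventually_sequentially)
    next
      case False
      then have "(indicator (?U n) x :: real) = indicator ((\<Union>i. B i) \<inter> {-c..c}) x" for n
        by (auto split: split_indicator)
      then show ?thesis by simp
    qed
  qed (use union(2) integrable_indicator_Int_Icc[of UNIV "-c" c] in \<open>auto intro!: integrable_indicator_Int_Icc split: split_indicator\<close>)
qed

text \<open>
  Indicators of sets of finite measure are reached by letting the window grow; integrable functions
  are limits of linear combinations of these.
\<close>

theorem Riemann_Lebesgue: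
  assumes "integrable lborel h"
  shows "(fourier h \<longlongrightarrow> 0) at_infinity"
  using assms
proof (induction rule: integrable_induct)
  case (base A c)
  have A: "A \<in> sets borel" using base by simp
  have "(fourier (indicator A) \<longlongrightarrow> 0) at_infinity"
  proof (rule fourier_vanishes_limit[where w = "indicator A" and s = "\<lambda>n. indicator (A \<inter> {-real n..real n})",
        OF _ _ _ _ _ fourier_indicator_bounded_vanishes[OF A]])
    show "(\<lambda>n. indicator (A \<inter> {-real n..real n}) x :: real) \<longlonglongrightarrow> indicator A x" for x
    proof -
      obtain k where "\<bar>x\<bar> \<le> real k" using real_arch_simple by blast
      then have "\<forall>n\<ge>k. (indicator (A \<inter> {-real n..real n}) x :: real) = indicator A x"
        by (auto split: split_indicator)
      then show ?thesis
        by (intro tendsto_eventually) (auto simp: eventually_sequentially)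
    qed
    show "integrable lborel (indicator A :: real \<Rightarrow> real)"
      using base by (intro integrable_real_indicator) auto
    then show "integrable lborel (indicator A :: real \<Rightarrow> real)" .
    show "integrable lborel (indicator (A \<inter> {-real n..real n}) :: real \<Rightarrow> real)" for n
      using A by (rule integrable_indicator_Int_Icc)
  qed (auto split: split_indicator)
  from tendsto_mult_left[OF this, of "complex_of_real c"]
  show ?case using fourier_scale[of c "indicator A"] by (simp add: mult.commute[of _ c])
next
  case (add f g)
  then show ?case
    using tendsto_add[OF add(3,4)] by (simp add: fourier_add)
next
  case (lim f s)
  then show ?case
    by (intro fourier_vanishes_limit[of s f "\<lambda>x. 2 * \<bar>f x\<bar>"]) auto
qed


section \<open>Smooth densities from integrable characteristic functions\<close>

text \<open>
  Differentiation under the integral sign: by the mean value inequality the difference quotients are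
  dominated by \<open>w\<close>, so dominated convergence applies along every sequence of increments. A null
  set of parameters is exempt, to accommodate the kernel of the Levy inversion formula, which is
  singular at the origin.
\<close>

lemma has_vector_derivative_lebesgue_integral:
  fixes k k' :: "real \<Rightarrow> 'a \<Rightarrow> 'b::{banach, second_countable_topology}"
  assumes int: "\<And>y. integrable M (k y)" and meas: "k' x \<in> borel_measurable M"
    and deriv: "AE t in M. \<forall>y. ((\<lambda>y. k y t) has_vector_derivative k' y t) (at y)"
    and bound: "\<And>y t. norm (k' y t) \<le> w t" and w: "integrable M w"
  shows "((\<lambda>y. integral\<^sup>L M (k y)) has_vector_derivative integral\<^sup>L M (k' x)) (at x)"
proof -
  have int': "integrable M (k' x)"
    using order_trans[OF bound abs_ge_self]
    by (intro Bochner_Integration.integrable_bound[OF w meas] AE_I2) simp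
  define r where "r h t = (k (x + h) t - k x t - h *\<^sub>R k' x t) /\<^sub>R \<bar>h\<bar>" for h t
  have lim: "((\<lambda>h. integral\<^sup>L M (r h)) \<longlongrightarrow> 0) (at 0)"
    unfolding tendsto_at_iff_sequentially o_def
  proof (intro allI impI)
    fix X :: "nat \<Rightarrow> real" assume X: "\<forall>i. X i \<in> UNIV - {0}" "X \<longlonglongrightarrow> 0"
    have "(\<lambda>i. integral\<^sup>L M (r (X i))) \<longlonglongrightarrow> integral\<^sup>L M (\<lambda>t. 0)"
    proof (rule integral_dominated_convergence[where w = "\<lambda>t. 2 * w t"])
      show "AE t in M. (\<lambda>i. r (X i) t) \<longlonglongrightarrow> 0"
        using deriv
      proof eventually_elim
        case (elim t)
        then have "(\<lambda>h. norm (k (x + h) t - k x t - h *\<^sub>R k' x t) / norm h) \<midarrow>0\<rightarrow> 0"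
          by (simp add: has_vector_derivative_def has_derivative_at)
        then have "((\<lambda>h. norm (r h t)) \<longlongrightarrow> 0) (at 0)"
          by (simp add: r_def divide_inverse mult.commute)
        then have "((\<lambda>h. r h t) \<longlongrightarrow> 0) (at 0)"
          by (rule tendsto_norm_zero_cancel)
        then show ?case
          using X unfolding tendsto_at_iff_sequentially o_def by blast
      qed
      show "AE t in M. norm (r (X i) t) \<le> 2 * w t" for i
        using deriv
      proof eventually_elim
        case (elim t)
        have "norm (k (x + X i) t - k x t) \<le> w t * norm (x + X i - x)"
        proof (rule differentiable_bound[of UNIV "\<lambda>y. k y t" "\<lambda>y h. h *\<^sub>R k' y t"])
          show "((\<lambda>y. k y t) has_derivative (\<lambda>h. h *\<^sub>R k' y t)) (at y within UNIV)" for y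
            using elim by (simp add: has_vector_derivative_def)
          have "\<bar>h\<bar> * norm (k' y t) \<le> w t * \<bar>h\<bar>" for h y
            using mult_left_mono[OF bound abs_ge_zero] by (simp add: mult.commute)
          then show "onorm (\<lambda>h. h *\<^sub>R k' y t) \<le> w t" for y
            by (intro onorm_le) simp
        qed auto
        moreover have "norm (X i *\<^sub>R k' x t) \<le> w t * \<bar>X i\<bar>"
          using mult_left_mono[OF bound[of x t] abs_ge_zero[of "X i"]] by (simp add: mult.commute)
        ultimately have "norm (k (x + X i) t - k x t - X i *\<^sub>R k' x t) \<le> (2 * w t) * \<bar>X i\<bar>"
          using norm_triangle_ineq4[of "k (x + X i) t - k x t" "X i *\<^sub>R k' x t"] by simp
        moreover have "X i \<noteq> 0" using X by auto
        moreover have "norm (r (X i) t) = norm (k (x + X i) t - k x t - X i *\<^sub>R k' x t) / \<bar>X i\<bar>"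
          by (simp add: r_def divide_inverse mult.commute)
        ultimately show ?case by (simp add: pos_divide_le_eq)
      qed
      show "r (X i) \<in> borel_measurable M" for i
        unfolding r_def[abs_def] using borel_measurable_integrable[OF int] meas
        by (intro borel_measurable_scaleR borel_measurable_diff borel_measurable_const)
    qed (use w in auto)
    then show "(\<lambda>i. integral\<^sup>L M (r (X i))) \<longlonglongrightarrow> 0" by simp
  qed
  have r: "integral\<^sup>L M (r h) = (integral\<^sup>L M (k (x + h)) - integral\<^sup>L M (k x) - h *\<^sub>R integral\<^sup>L M (k' x)) /\<^sub>R \<bar>h\<bar>" for h
    using int int' by (simp add: r_def[abs_def])
  from tendsto_norm_zero[OF lim]
  show ?thesis
    unfolding has_vector_derivative_def has_derivative_at
    by (simp add: r bounded_linear_scaleR_left divide_inverse mult.commute)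
qed

lemma has_vector_derivative_iexp_linear:
  "((\<lambda>y. iexp (- (t * y))) has_vector_derivative - \<i> * complex_of_real t * iexp (- (t * y))) (at y)"
proof -
  have "((\<lambda>y. - (t * y)) has_vector_derivative - t) (at y)"
    unfolding has_real_derivative_iff_has_vector_derivative[symmetric]
    by (auto intro!: derivative_eq_intros)
  from vector_diff_chain_at[OF this has_vector_derivative_iexp]
  show ?thesis by (simp add: o_def scaleR_conv_of_real mult_ac)
qed

context real_distribution
begin

text \<open>
  The inverse Fourier transform of the characteristic function, differentiated \<open>n\<close> times under the
  integral sign. The real part makes it a function with real values; the integral is in fact real.
\<close>

definition char_inverse :: "nat \<Rightarrow> real \<Rightarrow> real" where
  "char_inverse n x =
     Re ((LINT t|lborel. (- \<i> * complex_of_real t) ^ n * char M t * iexp (- (t * x))) / (2 * pi))"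

lemma char_inverse_deriv:
  assumes decay: "\<And>n. integrable lborel (\<lambda>t. \<bar>t\<bar> ^ n * cmod (char M t))"
  shows "(char_inverse n has_real_derivative char_inverse (Suc n) x) (at x)"
proof -
  define k where "k n y t = (- \<i> * complex_of_real t) ^ n * char M t * iexp (- (t * y))" for n :: nat and y t
  have norm_k: "norm (k n y t) = \<bar>t\<bar> ^ n * cmod (char M t)" for n y t
    using norm_exp_i_times[of "- (t * y)"] by (simp add: k_def norm_mult norm_power del: of_real_minus of_real_mult)
  have meas: "k n y \<in> borel_measurable lborel" for n y
    unfolding k_def[abs_def] by measurable
  have int: "integrable lborel (k n y)" for n y
    by (rule Bochner_Integration.integrable_bound[OF decay[of n] meas]) (simp add: norm_k)
  have D: "((\<lambda>y. k n y t) has_vector_derivative k (Suc n) y t) (at y)" for t y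
    unfolding k_def
    by (rule has_vector_derivative_mult_right[OF has_vector_derivative_iexp_linear, THEN has_vector_derivative_eq_rhs]) simp
  have "((\<lambda>y. integral\<^sup>L lborel (k n y)) has_vector_derivative integral\<^sup>L lborel (k (Suc n) x)) (at x)"
    by (rule has_vector_derivative_lebesgue_integral[OF int meas _ _ decay[of "Suc n"]])
       (auto simp: norm_k D)
  then have "((\<lambda>y. integral\<^sup>L lborel (k n y) / (2 * pi)) has_vector_derivative
      integral\<^sup>L lborel (k (Suc n) x) / (2 * pi)) (at x)"
    by (rule has_vector_derivative_divide)
  from bounded_linear.has_vector_derivative[OF bounded_linear_Re this]
  show ?thesis
    unfolding has_real_derivative_iff_has_vector_derivative char_inverse_def[abs_def] k_def[symmetric] .
qed

text \<open>
  Since there are no atoms, the Levy inversion formula gives \<open>M {a<..y}\<close> as a principal value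
  integral, which converges absolutely because the characteristic function is integrable. Its kernel
  \<open>(exp (- \<i> t a) - exp (- \<i> t y)) / (\<i> t)\<close> has the \<open>y\<close>-derivative \<open>exp (- \<i> t y)\<close>, so
  differentiating in \<open>y\<close> leaves the inverse transform.
\<close>

lemma cdf_deriv:
  assumes int: "integrable lborel (char M)" and no_atoms: "\<And>x. measure M {x} = 0"
  shows "(cdf M has_real_derivative char_inverse 0 x) (at x)"
proof -
  \<comment> \<open>The base point only has to lie to the left of \<open>x\<close>.\<close>
  define a where "a = x - 1"
  define k where "k y t = (iexp (- (t * a)) - iexp (- (t * y))) / (\<i> * t) * char M t" for y t
  define k' where "k' y t = char M t * iexp (- (t * y))" for y t
  have meas: "k y \<in> borel_measurable lborel" "k' y \<in> borel_measurable lborel" for y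
    unfolding k_def[abs_def] k'_def[abs_def] by measurable
  have norm_k': "norm (k' y t) = cmod (char M t)" for y t
    using norm_exp_i_times[of "- (t * y)"] by (simp add: k'_def norm_mult del: of_real_minus of_real_mult)
  have norm_k: "norm (k y t) \<le> \<bar>y - a\<bar> * cmod (char M t)" for y t
  proof (cases "t = 0")
    case False
    have "norm ((iexp (- (t * a)) - iexp (- (t * y))) / (\<i> * t)) \<le> \<bar>y - a\<bar>"
    proof (cases "a \<le> y")
      case True
      then show ?thesis using Levy_Inversion_aux2[of "-y" "-a" t] False by simp
    next
      case False
      then show ?thesis using Levy_Inversion_aux2[of "-a" "-y" t] \<open>t \<noteq> 0\<close>
        by (simp add: norm_divide norm_minus_commute)
    qed
    then show ?thesis unfolding k_def norm_mult by (rule mult_right_mono) simp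
  qed (simp add: k_def)
  have int_k: "integrable lborel (k y)" for y
    by (rule Bochner_Integration.integrable_bound[OF integrable_mult_right[OF integrable_norm[OF int], of "\<bar>y - a\<bar>"] meas(1)])
       (use norm_k in \<open>simp add: abs_mult\<close>)
  have D: "((\<lambda>y. k y t) has_vector_derivative k' y t) (at y)" if "t \<noteq> 0" for t y
  proof -
    from has_vector_derivative_mult_right[OF has_vector_derivative_diff[OF has_vector_derivative_const
          has_vector_derivative_iexp_linear[of t y]], of "char M t / (\<i> * t)" "iexp (- (t * a))"]
    show ?thesis using that by (simp add: k_def k'_def field_simps)
  qed
  define G where "G y = Re ((LINT t|lborel. k y t) / (2 * pi))" for y
  have "((\<lambda>y. integral\<^sup>L lborel (k y)) has_vector_derivative integral\<^sup>L lborel (k' x)) (at x)"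
  proof (rule has_vector_derivative_lebesgue_integral[OF int_k meas(2) _ _ integrable_norm[OF int]])
    show "AE t in lborel. \<forall>y. ((\<lambda>y. k y t) has_vector_derivative k' y t) (at y)"
      \<comment> \<open>At \<open>t = 0\<close> division by zero makes \<open>k y t\<close> vanish, whereas \<open>k' y t = 1\<close>.\<close>
      using AE_lborel_singleton[of 0] by eventually_elim (use D in blast)
  qed (simp add: norm_k')
  then have "((\<lambda>y. integral\<^sup>L lborel (k y) / (2 * pi)) has_vector_derivative
      integral\<^sup>L lborel (k' x) / (2 * pi)) (at x)"
    by (rule has_vector_derivative_divide)
  from bounded_linear.has_vector_derivative[OF bounded_linear_Re this]
  have G: "(G has_real_derivative char_inverse 0 x) (at x)"
    unfolding has_real_derivative_iff_has_vector_derivative G_def[abs_def] char_inverse_def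
    by (simp add: k'_def[abs_def] mult_ac)
  have cdf: "cdf M y = cdf M a + G y" if "a < y" for y
  proof -
    have "(\<lambda>T::nat. 1 / (2 * pi) * (CLBINT t=-real T..real T. k y t)) \<longlonglongrightarrow> complex_of_real (measure M {a<..y})"
      using Levy_Inversion[of a y] that no_atoms by (simp add: k_def)
    moreover have "(\<lambda>T::nat. 1 / (2 * pi) * (CLBINT t=-real T..real T. k y t)) \<longlonglongrightarrow> 1 / (2 * pi) * (LINT t|lborel. k y t)"
    proof (rule tendsto_mult_left)
      have "(\<lambda>T::nat. LINT t|lborel. indicator {-real T<..<real T} t *\<^sub>R k y t) \<longlonglongrightarrow> (LINT t|lborel. k y t)"
      proof (rule integral_dominated_convergence[where w = "\<lambda>t. norm (k y t)"])
        show "AE t in lborel. (\<lambda>T::nat. indicator {-real T<..<real T} t *\<^sub>R k y t) \<longlonglongrightarrow> k y t"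
        proof (rule AE_I2)
          fix t
          obtain m where "\<bar>t\<bar> < real m" using reals_Archimedean2 by blast
          then have "\<forall>n\<ge>m. indicator {-real n<..<real n} t *\<^sub>R k y t = k y t"
            by (auto split: split_indicator)
          then show "(\<lambda>T::nat. indicator {-real T<..<real T} t *\<^sub>R k y t) \<longlonglongrightarrow> k y t"
            by (intro tendsto_eventually) (auto simp: eventually_sequentially)
        qed
      qed (use meas int_k in \<open>auto split: split_indicator\<close>)
      then show "(\<lambda>T::nat. CLBINT t=-real T..real T. k y t) \<longlonglongrightarrow> (LINT t|lborel. k y t)"
        by (simp add: interval_lebesgue_integral_def set_lebesgue_integral_def)
    qed
    ultimately have "complex_of_real (measure M {a<..y}) = 1 / (2 * pi) * (LINT t|lborel. k y t)"
      by (rule LIMSEQ_unique)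
    then have "measure M {a<..y} = G y"
      unfolding G_def by (metis Re_complex_of_real divide_inverse inverse_eq_divide mult.commute of_real_divide of_real_1)
    then show ?thesis
      using finite_borel_measure.cdf_diff_eq[OF finite_borel_measure_M that] by simp
  qed
  have "((\<lambda>y. cdf M a + G y) has_real_derivative char_inverse 0 x) (at x)"
    by (auto intro!: derivative_eq_intros G)
  then show ?thesis
    by (rule has_field_derivative_transform_within_open[of _ _ _ "{a<..}"]) (auto simp: a_def cdf[unfolded a_def])
qed

end

text \<open>
  The distribution function of the law with density \<open>g\<close> has the smooth derivative \<open>f\<close> given by the
  inverse transform. It is nondecreasing, hence \<open>f \<ge> 0\<close>, and the fundamental theorem of calculus shows
  that \<open>f\<close> is a density of the same law. Uniqueness of densities gives \<open>g = f\<close> almost everywhere.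
\<close>

lemma smooth_ae_of_rapidly_decreasing_fourier:
  assumes nonneg: "AE v in lborel. 0 \<le> g v" and g: "has_bochner_integral lborel g 1"
    and decay: "\<And>n. integrable lborel (\<lambda>t. \<bar>t\<bar> ^ n * cmod (fourier g t))"
  shows "smooth_ae g"
proof -
  have int: "integrable lborel g" and one: "(LINT v|lborel. g v) = 1"
    using g by (auto simp: has_bochner_integral_iff)
  have [measurable]: "g \<in> borel_measurable borel"
    using borel_measurable_integrable[OF int] by simp
  define M where "M = density lborel (\<lambda>v. ennreal (g v))"
  have "emeasure M (space M) = 1"
    using nn_integral_eq_integral[OF int nonneg] one by (simp add: M_def emeasure_density)
  then interpret real_distribution M
    by (intro real_distribution.intro real_distribution_axioms.intro prob_spaceI) (simp_all add: M_def)
  have char: "char M t = fourier g (- t)" for t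
    unfolding char_def M_def fourier_def
    by (subst integral_density) (use nonneg in \<open>auto simp: scaleR_conv_of_real\<close>)
  have atoms: "measure M {x} = 0" for x
    by (simp add: M_def measure_def emeasure_density nn_integral_null_delta)
  have decay': "integrable lborel (\<lambda>t. \<bar>t\<bar> ^ n * cmod (char M t))" for n
    using lborel_integrable_real_affine[OF decay[of n], of "-1" 0] by (simp add: char)
  have int_char: "integrable lborel (char M)"
    using decay'[of 0] by (subst integrable_norm_iff[symmetric]) simp_all
  define f where "f = char_inverse"
  have f: "(f n has_real_derivative f (Suc n) x) (at x)" for n x
    unfolding f_def by (rule char_inverse_deriv[OF decay'])
  have cdf: "(cdf M has_real_derivative f 0 x) (at x)" for x
    unfolding f_def by (rule cdf_deriv[OF int_char atoms])
  have "(deriv ^^ n) (f 0) = f n" for n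
    by (induction n) (simp_all add: DERIV_imp_deriv[OF f, abs_def])
  then have "smooth (f 0)"
    unfolding smooth_def using f real_differentiable_def by auto
  moreover have "AE v in lborel. g v = f 0 v"
  proof -
    have pos: "0 \<le> f 0 x" for x
      by (rule mono_on_imp_deriv_nonneg[OF _ cdf, of UNIV])
         (auto intro!: mono_onI finite_borel_measure.cdf_nondecreasing[OF finite_borel_measure_M])
    have "continuous_on UNIV (f 0)"
      using f by (intro continuous_at_imp_continuous_on ballI DERIV_isCont) 
    then have [measurable]: "f 0 \<in> borel_measurable borel" by (rule borel_measurable_continuous_onI)
    have "M = density lborel (\<lambda>v. ennreal (f 0 v))"
    proof (rule measure_eqI_lessThan)
      fix x
      show "emeasure M {x<..} < \<infinity>" by (simp add: emeasure_eq_measure)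
      have "{x<..} = space M - {..x}" by (auto simp: M_def)
      then have "emeasure M {x<..} = ennreal (1 - cdf M x)"
        using prob_compl[of "{..x}"] by (simp add: emeasure_eq_measure cdf_def)
      also have "\<dots> = (\<integral>\<^sup>+v. ennreal (f 0 v) * indicator {x..} v \<partial>lborel)"
        by (rule nn_integral_FTC_atLeast[symmetric]) (use cdf pos cdf_lim_at_top_prob in auto)
      also have "\<dots> = (\<integral>\<^sup>+v. ennreal (f 0 v) * indicator {x<..} v \<partial>lborel)"
        using AE_lborel_singleton[of x] by (intro nn_integral_cong_AE) (auto split: split_indicator)
      finally show "emeasure M {x<..} = emeasure (density lborel (\<lambda>v. ennreal (f 0 v))) {x<..}"
        by (simp add: emeasure_density)
    qed (simp_all add: M_def)
    then have "AE v in lborel. ennreal (g v) = ennreal (f 0 v)"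
      unfolding M_def by (subst (asm) sigma_finite_measure.density_unique_iff[OF sigma_finite_lborel]) simp_all
    with nonneg show ?thesis by eventually_elim (use pos in simp)
  qed
  ultimately show ?thesis unfolding smooth_ae_def by blast
qed


section \<open>Decay of the transform\<close>

text \<open>
  With \<open>a = 1 / c\<close> the equation says that \<open>s powr (- a) * \<phi> s\<close> has the derivative
  \<open>- a * s powr (- a - 1) * F s\<close>. Integrating from \<open>\<xi>\<close> to infinity, where \<open>s powr (- a) * \<phi> s\<close> vanishes
  because \<open>\<phi>\<close> is bounded, exhibits \<open>\<phi> \<xi>\<close> as the average of \<open>F\<close> over \<open>{\<xi>..}\<close> with respect to the
  probability density \<open>a * \<xi> powr a * s powr (- a - 1)\<close>. The average cannot exceed the supremum.
\<close>

lemma norm_le_of_dilation_equation: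
  fixes \<phi> F :: "real \<Rightarrow> complex"
  assumes c: "c > 0" and \<xi>: "\<xi> > 0"
    and deriv: "\<And>s. (\<phi> has_vector_derivative \<phi>' s) (at s)"
    and eq: "\<And>s. s > 0 \<Longrightarrow> complex_of_real (c * s) * \<phi>' s = \<phi> s - F s"
    and bounded: "\<And>s. cmod (\<phi> s) \<le> B"
    and F: "\<And>s. s \<ge> \<xi> \<Longrightarrow> cmod (F s) \<le> K"
  shows "cmod (\<phi> \<xi>) \<le> K"
proof -
  define a where "a = 1 / c"
  have a: "a > 0" using c by (simp add: a_def)
  define u where "u s = (s powr - a) *\<^sub>R \<phi> s" for s
  have u: "(u has_vector_derivative (- a * s powr (- a - 1)) *\<^sub>R F s) (at s)" if "s > 0" for s
  proof -
    have "\<phi>' s = (a / s) *\<^sub>R (\<phi> s - F s)"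
      using eq[OF that, symmetric] that c by (simp add: a_def scaleR_conv_of_real)
    moreover have "s powr - a = s powr (- a - 1) * s"
      using that powr_add[of s "- a - 1" 1] by simp
    ultimately have "s powr - a *\<^sub>R \<phi>' s = (a * s powr (- a - 1)) *\<^sub>R (\<phi> s - F s)"
      using that by (simp add: mult.commute)
    then have rhs: "s powr - a *\<^sub>R \<phi>' s + (- a * s powr (- a - 1)) *\<^sub>R \<phi> s = (- a * s powr (- a - 1)) *\<^sub>R F s"
      by (simp add: algebra_simps)
    have "((\<lambda>s. s powr - a) has_real_derivative - a * s powr (- a - 1)) (at s)"
      using that by (auto intro!: derivative_eq_intros)
    from has_vector_derivative_scaleR[OF this deriv[of s]]
    show ?thesis unfolding u_def[abs_def] rhs .
  qed
  have v: "((\<lambda>s. - K * s powr - a) has_vector_derivative K * (a * s powr (- a - 1))) (at s)" if "s > 0" for s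
    unfolding has_real_derivative_iff_has_vector_derivative[symmetric]
    using that by (auto intro!: derivative_eq_intros)
  \<comment> \<open>On a bounded interval the mean value inequality takes the place of the integral.\<close>
  have le: "norm (u \<xi>) \<le> K * \<xi> powr - a + B * T powr - a - K * T powr - a" if T: "T > \<xi>" for T
  proof -
    have "norm (u T - u \<xi>) \<le> - K * T powr - a - (- K * \<xi> powr - a)"
    proof (rule differentiable_bound_general[OF T])
      show "continuous_on {\<xi>..T} u"
        using \<xi> by (intro continuous_at_imp_continuous_on ballI has_vector_derivative_continuous[OF u]) auto
      show "continuous_on {\<xi>..T} (\<lambda>s. - K * s powr - a)"
        using \<xi> by (intro continuous_at_imp_continuous_on ballI has_vector_derivative_continuous[OF v]) auto
      show "norm ((- a * s powr (- a - 1)) *\<^sub>R F s) \<le> K * (a * s powr (- a - 1))" if "\<xi> < s" "s < T" for s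
        using a F[of s] that by (simp add: abs_mult mult.commute mult_right_mono)
    qed (use u v \<xi> in auto)
    moreover have "norm (u T) \<le> B * T powr - a"
      using bounded[of T] by (simp add: u_def mult.commute mult_right_mono)
    ultimately show ?thesis
      using norm_triangle_sub[of "u \<xi>" "u T"] by (simp add: norm_minus_commute)
  qed
  have "((\<lambda>T. K * \<xi> powr - a + B * T powr - a - K * T powr - a) \<longlongrightarrow> K * \<xi> powr - a + B * 0 - K * 0) at_top"
    by (intro tendsto_intros tendsto_neg_powr a filterlim_ident) (use a in auto)
  then have "norm (u \<xi>) \<le> K * \<xi> powr - a + B * 0 - K * 0"
    by (rule tendsto_lowerbound) (auto simp: le eventually_at_top_dense intro!: exI[of _ \<xi>])
  then show ?thesis
    using \<xi> by (simp add: u_def mult.commute)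
qed

text \<open>
  Let \<open>M \<xi>\<close> be the supremum of \<open>norm (\<phi> s)\<close> over \<open>s \<ge> \<xi>\<close>. The hypothesis \<open>step\<close> says
  \<open>M \<xi> \<le> M (p * \<xi>) * M (q * \<xi>)\<close>, so \<open>N = - ln M\<close> satisfies \<open>N \<xi> \<ge> N (p * \<xi>) + N (q * \<xi>)\<close>. The function
  \<open>\<mu> * \<xi> powr l\<close> satisfies this with equality, precisely because \<open>p powr l + q powr l = 1\<close>. Hence a
  lower bound \<open>N \<xi> \<ge> \<mu> * \<xi> powr l\<close> on \<open>{R..R / q}\<close> propagates to \<open>{R..}\<close>: beyond \<open>R / q\<close> both \<open>p * \<xi>\<close> and
  \<open>q * \<xi>\<close> lie in \<open>{R..}\<close>, and the upper end of the range moves by the factor \<open>1 / p > 1\<close> in each step.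
\<close>

lemma stretched_exponential_decay:
  fixes \<phi> :: "real \<Rightarrow> 'a::real_normed_div_algebra"
  assumes pq: "0 < q" "q \<le> p" "p < 1" and l: "0 < l" "p powr l + q powr l = 1"
    and lim: "(\<phi> \<longlongrightarrow> 0) at_top"
    and step: "\<And>\<xi> K. \<xi> > 0 \<Longrightarrow> (\<And>s. s \<ge> \<xi> \<Longrightarrow> norm (\<phi> (p * s) * \<phi> (q * s)) \<le> K) \<Longrightarrow> norm (\<phi> \<xi>) \<le> K"
  obtains R \<mu> where "R > 0" "\<mu> > 0" "\<And>\<xi>. \<xi> \<ge> R \<Longrightarrow> norm (\<phi> \<xi>) \<le> exp (- \<mu> * \<xi> powr l)"
proof -
  have "\<forall>\<^sub>F s in at_top. dist (\<phi> s) 0 < 1 / 2"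
    using lim by (rule tendstoD) simp
  then obtain R0 where R0: "\<And>s. s \<ge> R0 \<Longrightarrow> norm (\<phi> s) \<le> 1 / 2"
    by (auto simp: eventually_at_top_linorder intro: less_imp_le)
  define R where "R = max R0 1"
  have R: "R > 0" "\<And>s. s \<ge> R \<Longrightarrow> norm (\<phi> s) \<le> 1 / 2"
    using R0 by (auto simp: R_def)
  \<comment> \<open>Chosen so that the bound at the far end \<open>R / q\<close> of the first interval is exactly \<open>1 / 2\<close>.\<close>
  define \<mu> where "\<mu> = ln 2 / (R / q) powr l"
  have \<mu>: "\<mu> > 0" using R pq by (simp add: \<mu>_def)
  have main: "\<forall>s\<ge>\<xi>. norm (\<phi> s) \<le> exp (- \<mu> * \<xi> powr l)"
    if "R \<le> \<xi>" "\<xi> \<le> R / q * (1 / p) ^ n" for n \<xi>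
    using that
  proof (induction n arbitrary: \<xi>)
    case 0
    then have "\<xi> powr l \<le> (R / q) powr l"
      using R l by (intro powr_mono2) auto
    then have "\<mu> * \<xi> powr l \<le> ln 2"
      using R pq by (simp add: \<mu>_def field_simps)
    then have "exp (- ln 2) \<le> exp (- \<mu> * \<xi> powr l)" by simp
    then have "1 / 2 \<le> exp (- \<mu> * \<xi> powr l)" by (simp add: exp_minus)
    then show ?case using R 0 by (meson order_trans)
  next
    case (Suc n)
    show ?case
    proof (cases "\<xi> \<le> R / q * (1 / p) ^ n")
      case True
      then show ?thesis using Suc by blast
    next
      case False
      have "1 \<le> (1 / p) ^ n" using pq by (intro one_le_power) auto
      then have "R / q \<le> R / q * (1 / p) ^ n"
        using R pq mult_left_mono[of 1 "(1 / p) ^ n" "R / q"] by simp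
      then have "R / q \<le> \<xi>" using False by simp
      then have q\<xi>: "R \<le> q * \<xi>" using pq by (simp add: field_simps)
      have \<xi>: "0 < \<xi>" using R Suc.prems by simp
      have qp: "q * \<xi> \<le> p * \<xi>" using pq \<xi> by simp
      have p\<xi>: "p * \<xi> \<le> R / q * (1 / p) ^ n"
        using Suc.prems(2) pq by (simp add: field_simps)
      have P: "\<forall>s\<ge>p * \<xi>. norm (\<phi> s) \<le> exp (- \<mu> * (p * \<xi>) powr l)"
        using Suc.IH[of "p * \<xi>"] q\<xi> qp p\<xi> by simp
      have Q: "\<forall>s\<ge>q * \<xi>. norm (\<phi> s) \<le> exp (- \<mu> * (q * \<xi>) powr l)"
        using Suc.IH[of "q * \<xi>"] q\<xi> qp p\<xi> by simp
      have "exp (- \<mu> * (p * \<xi>) powr l) * exp (- \<mu> * (q * \<xi>) powr l) = exp (- \<mu> * (p powr l + q powr l) * \<xi> powr l)"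
        using pq \<xi> by (simp add: exp_add[symmetric] powr_mult algebra_simps)
      also have "\<dots> = exp (- \<mu> * \<xi> powr l)" using l by simp
      finally have prod: "exp (- \<mu> * (p * \<xi>) powr l) * exp (- \<mu> * (q * \<xi>) powr l) = exp (- \<mu> * \<xi> powr l)" .
      show ?thesis
      proof (intro allI impI)
        fix s assume s: "\<xi> \<le> s"
        show "norm (\<phi> s) \<le> exp (- \<mu> * \<xi> powr l)"
        proof (rule step)
          fix t assume "s \<le> t"
          then have "p * \<xi> \<le> p * t" "q * \<xi> \<le> q * t" using s pq by auto
          then show "norm (\<phi> (p * t) * \<phi> (q * t)) \<le> exp (- \<mu> * \<xi> powr l)"
            unfolding prod[symmetric] norm_mult using P Q by (intro mult_mono) auto
        qed (use s \<xi> in simp)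
      qed
    qed
  qed
  show ?thesis
  proof (rule that[OF R(1) \<mu>])
    fix \<xi> assume \<xi>: "R \<le> \<xi>"
    have "1 < 1 / p" using pq by simp
    then obtain n where "\<xi> * q / R < (1 / p) ^ n" using real_arch_pow by blast
    then have "\<xi> \<le> R / q * (1 / p) ^ n" using R pq by (simp add: field_simps)
    from main[OF \<xi> this] show "norm (\<phi> \<xi>) \<le> exp (- \<mu> * \<xi> powr l)" by simp
  qed
qed

text \<open>
  The stretched exponential beats every power; comparison with \<open>1 / (1 + t\<^sup>2)\<close> gives integrability.
\<close>

lemma gevrey_rapidly_decreasing:
  fixes \<phi> :: "real \<Rightarrow> complex"
  assumes meas: "\<phi> \<in> borel_measurable borel" and l: "l > 0" and \<mu>: "\<mu> > 0"
    and bounded: "\<And>t. cmod (\<phi> t) \<le> B"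
    and decay: "\<And>t. \<bar>t\<bar> > \<rho> \<Longrightarrow> cmod (\<phi> t) \<le> exp (- \<mu> * \<bar>t\<bar> powr l)"
  shows "integrable lborel (\<lambda>t. \<bar>t\<bar> ^ n * cmod (\<phi> t))"
proof -
  have "((\<lambda>x::real. x powr real n * (1 + x\<^sup>2) * exp (- \<mu> * x powr l)) \<longlongrightarrow> 0) at_top"
    using l \<mu> by real_asymp
  then have "\<forall>\<^sub>F x in at_top. x powr real n * (1 + x\<^sup>2) * exp (- \<mu> * x powr l) < 1"
    by (rule order_tendstoD) simp
  then obtain X where X: "\<And>x. x \<ge> X \<Longrightarrow> x powr real n * (1 + x\<^sup>2) * exp (- \<mu> * x powr l) < 1"
    by (auto simp: eventually_at_top_linorder)
  define Y where "Y = max (max X \<rho>) 0 + 1"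
  have B: "0 \<le> B" using bounded[of 0] norm_ge_zero order_trans by blast
  have main: "\<bar>t\<bar> ^ n * cmod (\<phi> t) \<le> (Y ^ n * B * (1 + Y\<^sup>2) + 1) * inverse (1 + t\<^sup>2)" for t
  proof -
    have pos: "1 + t\<^sup>2 > 0" by (simp add: add_pos_nonneg)
    have "\<bar>t\<bar> ^ n * cmod (\<phi> t) * (1 + t\<^sup>2) \<le> Y ^ n * B * (1 + Y\<^sup>2) + 1"
    proof (cases "\<bar>t\<bar> \<le> Y")
      case True
      then have "t\<^sup>2 \<le> Y\<^sup>2" by (metis abs_ge_zero power2_abs power_mono)
      then have "\<bar>t\<bar> ^ n * cmod (\<phi> t) * (1 + t\<^sup>2) \<le> Y ^ n * B * (1 + Y\<^sup>2)"
        using True B bounded[of t] by (intro mult_mono power_mono) (auto simp: Y_def)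
      then show ?thesis by simp
    next
      case False
      then have t: "\<bar>t\<bar> > \<rho>" "\<bar>t\<bar> \<ge> X" "\<bar>t\<bar> > 0" by (auto simp: Y_def)
      have "\<bar>t\<bar> ^ n * cmod (\<phi> t) * (1 + t\<^sup>2) \<le> \<bar>t\<bar> ^ n * exp (- \<mu> * \<bar>t\<bar> powr l) * (1 + t\<^sup>2)"
        using decay[OF t(1)] pos by (intro mult_right_mono mult_left_mono) auto
      also have "\<dots> \<le> 1"
        using X[OF t(2)] t(3) by (simp add: powr_realpow mult.commute mult.left_commute)
      also have "\<dots> \<le> Y ^ n * B * (1 + Y\<^sup>2) + 1"
        using B by (simp add: Y_def)
      finally show ?thesis .
    qed
    then show ?thesis using pos by (simp add: divide_inverse[symmetric] pos_le_divide_eq)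
  qed
  have "integrable lborel (\<lambda>t::real. inverse (1 + t\<^sup>2))"
    using integrable_inverse_1_plus_square by (simp add: set_integrable_def)
  from integrable_mult_right[OF this, of "Y ^ n * B * (1 + Y\<^sup>2) + 1"]
  show ?thesis
  proof (rule Bochner_Integration.integrable_bound)
    show "AE t in lborel. norm (\<bar>t\<bar> ^ n * cmod (\<phi> t)) \<le> norm ((Y ^ n * B * (1 + Y\<^sup>2) + 1) * inverse (1 + t\<^sup>2))"
      using order_trans[OF main abs_ge_self] by (intro AE_I2) (simp only: real_norm_def abs_mult power_abs[symmetric] abs_norm_cancel abs_idempotent)
  qed (use meas in measurable)
qed


section \<open>Gevrey regularity of the steady state\<close>

theorem theorem2:
  fixes p q \<delta>0 l :: real and g :: "real \<Rightarrow> real"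
  assumes "0 < q" and "q \<le> p" and "p\<^sup>2 + q\<^sup>2 < 1"
    and "0 < \<delta>0" and "\<delta>0 < 1"
    and "\<And>\<delta>. 0 < \<delta> \<Longrightarrow> \<delta> < \<delta>0 \<Longrightarrow> S_fun p q \<delta> < 0"
    and "steady_state p q \<delta>0 g"
    and "0 < l" and "l < 2" and "p powr l + q powr l = 1"
  shows "smooth_ae g \<and> gevrey l g"
proof -
  from \<open>steady_state p q \<delta>0 g\<close>
  have nonneg: "AE v in lborel. 0 \<le> g v" and g: "has_bochner_integral lborel g 1"
    and diff: "\<And>\<xi>. fourier g differentiable (at \<xi>)"
    and eq: "\<And>\<xi>. complex_of_real (1 / 2 * (p\<^sup>2 + q\<^sup>2 - 1) * \<xi>) * vector_derivative (fourier g) (at \<xi>)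
            = fourier g (p * \<xi>) * fourier g (q * \<xi>) - fourier g \<xi>"
    unfolding steady_state_def by blast+
  have int: "integrable lborel g" using g by (simp add: has_bochner_integral_iff)
  have "p\<^sup>2 < 1"
    using \<open>p\<^sup>2 + q\<^sup>2 < 1\<close> zero_le_power2[of q] by linarith
  then have p: "p < 1" by (simp add: power_less_one_iff abs_square_less_1)
  have step: "norm (fourier g \<xi>) \<le> K"
    if "\<xi> > 0" "\<And>s. s \<ge> \<xi> \<Longrightarrow> norm (fourier g (p * s) * fourier g (q * s)) \<le> K" for \<xi> K
  proof (rule norm_le_of_dilation_equation[where c = "(1 - p\<^sup>2 - q\<^sup>2) / 2" and B = "LINT v|lborel. \<bar>g v\<bar>"
        and F = "\<lambda>s. fourier g (p * s) * fourier g (q * s)"])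
    show "(fourier g has_vector_derivative vector_derivative (fourier g) (at s)) (at s)" for s
      using diff vector_derivative_works by blast
    show "complex_of_real ((1 - p\<^sup>2 - q\<^sup>2) / 2 * s) * vector_derivative (fourier g) (at s)
        = fourier g s - fourier g (p * s) * fourier g (q * s)" for s
    proof -
      have "(1 - p\<^sup>2 - q\<^sup>2) / 2 * s = - (1 / 2 * (p\<^sup>2 + q\<^sup>2 - 1) * s)" by (simp add: field_simps)
      then show ?thesis using eq[of s] by (simp only: of_real_minus mult_minus_left minus_diff_eq)
    qed
  qed (use that \<open>p\<^sup>2 + q\<^sup>2 < 1\<close> norm_fourier_le in auto)
  have "(fourier g \<longlongrightarrow> 0) at_top"
    using tendsto_mono[OF at_top_le_at_infinity Riemann_Lebesgue[OF int]] .
  from stretched_exponential_decay[OF \<open>0 < q\<close> \<open>q \<le> p\<close> p \<open>0 < l\<close> \<open>p powr l + q powr l = 1\<close> this step]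
  obtain R \<mu> where R: "R > 0" and \<mu>: "\<mu> > 0"
    and decay: "\<And>\<xi>. \<xi> \<ge> R \<Longrightarrow> norm (fourier g \<xi>) \<le> exp (- \<mu> * \<xi> powr l)"
    by blast
  have sym: "cmod (fourier g \<bar>\<xi>\<bar>) = cmod (fourier g \<xi>)" for \<xi>
    by (simp add: abs_if fourier_minus)
  have decay': "cmod (fourier g \<xi>) \<le> exp (- \<mu> * \<bar>\<xi>\<bar> powr l)" if "\<bar>\<xi>\<bar> > R" for \<xi>
    using decay[of "\<bar>\<xi>\<bar>"] that by (simp add: sym)
  have "continuous_on UNIV (fourier g)"
    using diff by (intro continuous_at_imp_continuous_on ballI differentiable_imp_continuous_within)
  then have "fourier g \<in> borel_measurable borel" by (rule borel_measurable_continuous_onI)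
  from gevrey_rapidly_decreasing[OF this \<open>0 < l\<close> \<mu> norm_fourier_le decay']
  have "smooth_ae g"
    by (rule smooth_ae_of_rapidly_decreasing_fourier[OF nonneg g])
  moreover have "gevrey l g"
    unfolding gevrey_def using R \<mu> decay' by blast
  ultimately show ?thesis ..
qed

end
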